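(* For all arithmetic functions $f,g$ and every integer $k\ge1$, \[ \sum_{d\mid k}\sum_{r=0}^{k-1}d\cdot L_{f,g,r}(k)\,e\!\left(-\frac{rd}{k}\right)\mu(k/d)=\sum_{d\mid k}\phi(d)\,f(d)\,(k/d)^2\,g(k/d). \]
   Context: For arithmetic functions $f,g$, integers $r\ge0$ and $k\ge1$, $L_{f,g,r}(k):=\sum_{d\mid\gcd(r,k)}f(d)\,g(k/d)$, with the convention $\gcd(0,k)=k$. $e(x):=\exp(2\pi i x)$. $\mu$ is the Möbius function and $\phi$ is Euler's totient function. *)

theory Defs
  imports
    "HOL-Analysis.Analysis"
    "HOL-Number_Theory.Number_Theory"
    "HOL-Computational_Algebra.Squarefree"
begin

text \<open>
  Arithmetic functions are functions \<open>nat \<Rightarrow> complex\<close>; their value at \<open>0\<close> is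
  never used below, since only positive \<open>k\<close> occur.
\<close>

definition moebius_mu :: "nat \<Rightarrow> int" where
  "moebius_mu n = (if squarefree n then (-1) ^ card (prime_factors n) else 0)"

text \<open>The convention \<open>gcd(0, k) = k\<close> holds for the library's \<open>gcd\<close> by definition.\<close>

definition L_sum :: "(nat \<Rightarrow> complex) \<Rightarrow> (nat \<Rightarrow> complex) \<Rightarrow> nat \<Rightarrow> nat \<Rightarrow> complex" where
  "L_sum f g r k = (\<Sum>d | d dvd gcd r k. f d * g (k div d))"

definition e_circ :: "real \<Rightarrow> complex" where
  "e_circ x = exp (2 * of_real pi * \<i> * of_real x)"

end

theory Submission
  imports Defs
begin

text \<open>
  Exchanging the sums, the coefficient of \<open>f c * g (k div c)\<close> contains the complete exponential sum
  over the multiples \<open>r\<close> of \<open>c\<close> below \<open>k\<close>. With \<open>q = k div c\<close> it equals \<open>q\<close> if \<open>q dvd d\<close> and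
  vanishes otherwise. Writing the surviving \<open>d\<close> as \<open>q * m\<close> with \<open>m dvd c\<close> leaves
  \<open>q\<^sup>2\<close> times the sum of \<open>m * \<mu> (c div m)\<close> over \<open>m dvd c\<close>, which is \<open>\<phi> c\<close>.
\<close>

lemma prod_prime_factors_squarefree:
  fixes d :: nat
  assumes "squarefree d"
  shows "\<Prod>(prime_factors d) = d"
proof -
  have "d \<noteq> 0" using assms by (metis not_squarefree_0)
  then have "d = (\<Prod>p\<in>prime_factors d. p ^ multiplicity p d)"
    by (simp add: prime_factorization_nat)
  also have "\<dots> = \<Prod>(prime_factors d)"
    using assms \<open>d \<noteq> 0\<close> by (intro prod.cong) (auto simp: squarefree_factorial_semiring')
  finally show ?thesis ..
qed

lemma prime_factors_prod_primes:
  fixes S :: "nat set"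
  assumes "finite S" "\<And>p. p \<in> S \<Longrightarrow> prime p"
  shows "prime_factors (\<Prod>S) = S"
proof -
  \<comment> \<open>The identity image is the form in which \<open>prime_factors_prod\<close> asks
    for nonzero factors.\<close>
  have "0 \<notin> (\<lambda>p. p) ` S" using assms(2)[of 0] by auto
  then show ?thesis
    using assms by (auto simp: prime_factors_prod prime_prime_factors)
qed

lemma squarefree_prod_primes:
  fixes S :: "nat set"
  assumes "\<And>p. p \<in> S \<Longrightarrow> prime p"
  shows "squarefree (\<Prod>S)"
  using assms by (intro squarefree_prod_coprime) (auto simp: primes_coprime squarefree_prime)

text \<open>Only squarefree divisors contribute, and taking prime factors matches them with the
  subsets of \<open>prime_factors n\<close>. The sum is then the expansion of the product over these
  subsets.\<close>

lemma sum_moebius_mu_div: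
  fixes n :: nat
  assumes "n > 0"
  shows "(\<Sum>d | d dvd n. of_int (moebius_mu d) / real d) = (\<Prod>p\<in>prime_factors n. 1 - 1 / real p)"
proof -
  have fin: "finite {d. d dvd n}" using assms by simp
  have "(\<Sum>d | d dvd n. of_int (moebius_mu d) / real d)
      = (\<Sum>d | d dvd n \<and> squarefree d. (-1) ^ card (prime_factors d) / real d)"
    using fin by (intro sum.mono_neutral_cong_right) (auto simp: moebius_mu_def)
  also have "\<dots> = (\<Sum>S\<in>Pow (prime_factors n). (-1) ^ card S * (\<Prod>p\<in>S. 1 / real p))"
  proof (rule sum.reindex_bij_witness[of _ "\<lambda>S. \<Prod>S" prime_factors])
    fix d assume d: "d \<in> {d. d dvd n \<and> squarefree d}"
    then show "\<Prod>(prime_factors d) = d" by (simp add: prod_prime_factors_squarefree)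
    show "prime_factors d \<in> Pow (prime_factors n)"
      using d assms by (auto dest: dvd_prime_factors[rotated])
    show "(-1) ^ card (prime_factors d) * (\<Prod>p\<in>prime_factors d. 1 / real p)
        = (-1) ^ card (prime_factors d) / real d"
      using d by (simp add: prod_dividef prod_prime_factors_squarefree flip: of_nat_prod)
  next
    fix S assume S: "S \<in> Pow (prime_factors n)"
    then have fin: "finite S" and primes: "\<And>p. p \<in> S \<Longrightarrow> prime p"
      by (auto intro: finite_subset)
    show "prime_factors (\<Prod>S) = S" using fin primes by (rule prime_factors_prod_primes)
    have "\<Prod>S dvd \<Prod>(prime_factors n)"
      using S by (intro prod_dvd_prod_subset) auto
    \<comment> \<open>Prime factors have positive multiplicity, so each \<open>p\<close> divides its
      own power.\<close>
    also have "\<dots> dvd (\<Prod>p\<in>prime_factors n. p ^ multiplicity p n)"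
      by (intro prod_dvd_prod dvd_power) (auto simp: prime_factors_multiplicity)
    also have "\<dots> = n"
      using assms by (simp flip: prime_factorization_nat)
    finally show "\<Prod>S \<in> {d. d dvd n \<and> squarefree d}"
      using primes by (simp add: squarefree_prod_primes)
  qed
  also have "\<dots> = (\<Prod>p\<in>prime_factors n. 1 - 1 / real p)"
    by (subst prod_diff_conv_sum) simp_all
  finally show ?thesis .
qed

text \<open>Passing to complementary divisors and pulling out \<open>n\<close> leaves the sum of
  \<open>sum_moebius_mu_div\<close>, so Euler's product formula for the totient applies. The
  computation runs over the reals because of the quotients by \<open>d\<close>.\<close>

lemma sum_divisors_times_moebius_mu:
  fixes n :: nat
  assumes "n > 0"
  shows "(\<Sum>d | d dvd n. int d * moebius_mu (n div d)) = int (totient n)"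
proof -
  have "(\<Sum>d | d dvd n. real d * of_int (moebius_mu (n div d)))
      = (\<Sum>d | d dvd n. real (n div d) * of_int (moebius_mu d))"
    using assms by (intro sum.reindex_bij_witness[of _ "\<lambda>d. n div d" "\<lambda>d. n div d"])
      (auto simp: div_dvd_iff_mult elim!: dvdE)
  also have "\<dots> = real n * (\<Sum>d | d dvd n. of_int (moebius_mu d) / real d)"
    unfolding sum_distrib_left by (intro sum.cong) (auto simp: real_of_nat_div)
  also have "\<dots> = real (totient n)"
    using assms by (simp add: sum_moebius_mu_div totient_formula2)
  finally have "real_of_int (\<Sum>d | d dvd n. int d * moebius_mu (n div d)) = real_of_int (int (totient n))"
    by simp
  then show ?thesis by (simp only: of_int_eq_iff)
qed

text \<open>This is a geometric sum whose ratio \<open>z\<close> is a \<open>q\<close>-th root of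
  unity, equal to 1 exactly when \<open>q\<close> divides \<open>d\<close>.\<close>

lemma sum_e_circ:
  assumes "q > 0"
  shows "(\<Sum>s<q. e_circ (- (real s * real d / real q))) = (if q dvd d then of_nat q else 0)"
proof -
  define z where "z = e_circ (- (real d / real q))"
  have pow: "e_circ (- (real s * real d / real q)) = z ^ s" for s
    unfolding z_def e_circ_def by (simp add: algebra_simps flip: exp_of_nat_mult)
  have "z ^ q = e_circ (- real d)"
    using pow[of q] assms by simp
  then have zq: "z ^ q = 1"
    by (auto simp: e_circ_def exp_eq_1 intro!: exI[of _ "- int d"])
  have z1: "z = 1 \<longleftrightarrow> q dvd d"
  proof
    assume "z = 1"
    then obtain n :: int where "- (2 * pi * real d / real q) = 2 * of_int n * pi"
      by (auto simp: z_def e_circ_def exp_eq_1)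
    then have "pi * (- real d) = pi * (of_int n * real q)"
      using assms by (simp add: field_simps)
    then have "- real d = of_int n * real q"
      by (simp only: mult_cancel_left pi_neq_zero simp_thms)
    then have "real_of_int (int d) = real_of_int (int q * - n)"
      by (simp add: algebra_simps)
    then have "int d = int q * - n" by (simp only: of_int_eq_iff)
    then have "int q dvd int d" by simp
    then show "q dvd d" by simp
  next
    assume "q dvd d"
    then obtain m where "d = q * m" ..
    then show "z = 1"
      \<comment> \<open>Since \<open>d = q * m\<close>, the angle of \<open>z\<close> is
        \<open>- m\<close> full turns.\<close>
      using assms by (auto simp: z_def e_circ_def exp_eq_1 intro!: exI[of _ "- int m"])
  qed
  show ?thesis
    using z1 zq by (cases "z = 1") (simp_all add: pow geometric_sum)
qed

text \<open>A divisor of \<open>gcd r k\<close> is a divisor \<open>c\<close> of \<open>k\<close>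
  that also divides \<open>r\<close>, so the two sums can be swapped. For \<open>k = c * q\<close>
  and \<open>r = c * s\<close>, the fraction \<open>r / k\<close> reduces to \<open>s / q\<close>,
  and \<open>sum_e_circ\<close> applies.\<close>

lemma sum_L_sum_e_circ:
  assumes "k > 0"
  shows "(\<Sum>r<k. L_sum f g r k * e_circ (- (real r * real d / real k)))
       = (\<Sum>c | c dvd k. f c * g (k div c) * (if k div c dvd d then of_nat (k div c) else 0))"
proof -
  let ?e = "\<lambda>r. e_circ (- (real r * real d / real k))"
  have fin: "finite {c. c dvd k}" using assms by simp
  have "(\<Sum>r<k. L_sum f g r k * ?e r)
      = (\<Sum>r<k. \<Sum>c | c dvd k. if c dvd r then f c * g (k div c) * ?e r else 0)"
  proof (rule sum.cong)
    fix r
    have "L_sum f g r k = (\<Sum>c | c dvd k. if c dvd r then f c * g (k div c) else 0)"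
      unfolding L_sum_def using fin by (intro sum.mono_neutral_cong_left) auto
    then show "L_sum f g r k * ?e r = (\<Sum>c | c dvd k. if c dvd r then f c * g (k div c) * ?e r else 0)"
      by (simp add: sum_distrib_right if_distrib[of "\<lambda>x. x * _"] cong: if_cong)
  qed simp
  also have "\<dots> = (\<Sum>c | c dvd k. \<Sum>r<k. if c dvd r then f c * g (k div c) * ?e r else 0)"
    by (rule sum.swap)
  also have "\<dots> = (\<Sum>c | c dvd k. f c * g (k div c) * (if k div c dvd d then of_nat (k div c) else 0))"
  proof (rule sum.cong)
    fix c assume "c \<in> {c. c dvd k}"
    then obtain q where k: "k = c * q" by auto
    then have pos: "c > 0" "q > 0" using assms by auto
    have "(\<Sum>r<k. if c dvd r then f c * g (k div c) * ?e r else 0)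
        = (\<Sum>r | r < k \<and> c dvd r. f c * g q * ?e r)"
      using k pos by (intro sum.mono_neutral_cong_right) auto
    also have "\<dots> = (\<Sum>s<q. f c * g q * e_circ (- (real s * real d / real q)))"
      using k pos
      by (intro sum.reindex_bij_witness[of _ "\<lambda>s. c * s" "\<lambda>r. r div c"])
        (auto elim!: dvdE)
    also have "\<dots> = f c * g q * (if q dvd d then of_nat q else 0)"
      using pos by (simp add: sum_e_circ flip: sum_distrib_left)
    finally show "(\<Sum>r<k. if c dvd r then f c * g (k div c) * ?e r else 0)
        = f c * g (k div c) * (if k div c dvd d then of_nat (k div c) else 0)"
      using k pos by simp
  qed simp
  finally show ?thesis .
qed

lemma sum_multiples_times_moebius_mu:
  fixes c q :: nat
  assumes "c > 0" "q > 0"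
  shows "(\<Sum>d | d dvd c * q \<and> q dvd d. int d * moebius_mu (c * q div d)) = int q * int (totient c)"
proof -
  have "(\<Sum>d | d dvd c * q \<and> q dvd d. int d * moebius_mu (c * q div d))
      = (\<Sum>m | m dvd c. int q * (int m * moebius_mu (c div m)))"
    using assms
    by (intro sum.reindex_bij_witness[of _ "\<lambda>m. q * m" "\<lambda>d. d div q"])
      (auto simp: mult.commute[of c q] elim!: dvdE[of q])
  also have "\<dots> = int q * int (totient c)"
    using assms by (simp add: sum_divisors_times_moebius_mu flip: sum_distrib_left)
  finally show ?thesis .
qed

theorem theorem4p14:
  fixes f g :: "nat \<Rightarrow> complex" and k :: nat
  assumes "k \<ge> 1"
  shows "(\<Sum>d | d dvd k. \<Sum>r = 0..k - 1.
            of_nat d * L_sum f g r k * e_circ (- (real r * real d / real k))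
              * of_int (moebius_mu (k div d)))
       = (\<Sum>d | d dvd k. of_nat (totient d) * f d * of_nat (k div d) ^ 2 * g (k div d))"
proof -
  let ?w = "\<lambda>d. int d * moebius_mu (k div d)"
  have k: "k > 0" using assms by simp
  \<comment> \<open>Positivity of \<open>k\<close> matters here: the subtraction truncates at
    0.\<close>
  then have ivl: "{0..k - 1} = {..<k}" by auto
  have fin: "finite {d. d dvd k}" using k by simp
  have "(\<Sum>d | d dvd k. \<Sum>r = 0..k - 1.
            of_nat d * L_sum f g r k * e_circ (- (real r * real d / real k))
              * of_int (moebius_mu (k div d)))
      = (\<Sum>d | d dvd k. of_int (?w d) *
          (\<Sum>r<k. L_sum f g r k * e_circ (- (real r * real d / real k))))"
    unfolding ivl sum_distrib_left by (simp add: mult_ac)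
  \<comment> \<open>The divisibility condition moves onto the integer weight \<open>?w d\<close>, so
    that after the swap the sum over \<open>d\<close> is evaluated in the integers.\<close>
  also have "\<dots> = (\<Sum>d | d dvd k. \<Sum>c | c dvd k.
      f c * g (k div c) * of_nat (k div c) * of_int (if k div c dvd d then ?w d else 0))"
    unfolding sum_L_sum_e_circ[OF k] sum_distrib_left
    by (intro sum.cong refl) simp
  also have "\<dots> = (\<Sum>c | c dvd k. \<Sum>d | d dvd k.
      f c * g (k div c) * of_nat (k div c) * of_int (if k div c dvd d then ?w d else 0))"
    by (rule sum.swap)
  also have "\<dots> = (\<Sum>c | c dvd k. f c * g (k div c) * of_nat (k div c) *
      of_int (\<Sum>d | d dvd k. if k div c dvd d then ?w d else 0))"
    by (simp only: of_int_sum sum_distrib_left)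
  also have "\<dots> = (\<Sum>c | c dvd k. of_nat (totient c) * f c * of_nat (k div c) ^ 2 * g (k div c))"
  proof (rule sum.cong)
    fix c assume "c \<in> {c. c dvd k}"
    then obtain q where q: "k = c * q" by auto
    then have pos: "c > 0" "q > 0" using k by auto
    have "(\<Sum>d | d dvd k. if k div c dvd d then ?w d else 0)
        = (\<Sum>d | d dvd c * q \<and> q dvd d. int d * moebius_mu (c * q div d))"
      using fin q pos by (intro sum.mono_neutral_cong_right) auto
    also have "\<dots> = int q * int (totient c)"
      using pos by (rule sum_multiples_times_moebius_mu)
    finally show "f c * g (k div c) * of_nat (k div c) *
        of_int (\<Sum>d | d dvd k. if k div c dvd d then ?w d else 0)
        = of_nat (totient c) * f c * of_nat (k div c) ^ 2 * g (k div c)"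
      \<comment> \<open>One factor \<open>q\<close> of the square is the value of the exponential
        sum, the other comes from the sum over the multiples of \<open>q\<close>.\<close>
      using q pos by (simp add: power2_eq_square)
  qed simp
  finally show ?thesis .
qed

end
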